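(* Let $k^H_w(z)=\frac{1}{1-\bar w z}$, $z,w\in\mathbb{D}$, be the reproducing kernel (Szegő kernel) of the Hardy space $H^2$ of the unit disk $\mathbb{D}$. Then $$\det\left((k^H_{b_j}(a_i))_{1\le i,j\le n}\right)\neq 0$$ for every pair of disjoint subsets $\mathbf{a}=\{a_1,\dots,a_n\}$ and $\mathbf{b}=\{b_1,\dots,b_n\}$ of $\mathbb{D}$ (each with $n$ elements).
   Context: $\mathbb{D}=\{z\in\mathbb{C}:|z|<1\}$. *)

theory Defs
  imports Complex_Main "Jordan_Normal_Form.Determinant"
begin

definition unit_disk :: "complex set" where
  "unit_disk = {z. cmod z < 1}"

text \<open>The Szego kernel \<open>k\<^sup>H\<^sub>w(z)\<close>, i.e. the reproducing kernel of the Hardy space \<open>H\<^sup>2\<close> of the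
  unit disk. The first argument is the point \<open>w\<close> (conjugated), the second the variable \<open>z\<close>.\<close>

definition szego_kernel :: "complex \<Rightarrow> complex \<Rightarrow> complex" where
  "szego_kernel w z = 1 / (1 - cnj w * z)"

end

(* The matrix is of Cauchy type. Clearing denominators in a null vector v gives the polynomial
   P(x) = \<Sum>j. v j * (\<Prod>k\<noteq>j. 1 - c k * x) of degree less than n, which vanishes at the n points a i
   and hence identically. Evaluating P at 1 / c j isolates v j whenever c j \<noteq> 0; at most one index
   with c j = 0 remains, and evaluating P at 0 isolates its coefficient. *)

theory Submission
  imports Defs
begin

text \<open>At \<open>1 / c i\<close> with \<open>c i\<close> nonzero, every product except the one
  omitting \<open>i\<close> contains the factor \<open>1 - c i * (1 / c i) = 0\<close>, so only the
  term of \<open>v i\<close> survives.\<close>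

lemma sum_eq_0_kernel_polynomial_imp_0:
  fixes v c :: "nat \<Rightarrow> 'a :: field"
  assumes inj: "inj_on c {..<n}"
    and zero: "\<And>x. (\<Sum>j<n. v j * (\<Prod>k\<in>{..<n} - {j}. 1 - c k * x)) = 0"
    and "j < n"
  shows "v j = 0"
proof -
  have nz: "v i = 0" if "i < n" "c i \<noteq> 0" for i
  proof -
    let ?x = "1 / c i"
    have "(\<Prod>k\<in>{..<n} - {l}. 1 - c k * ?x) = 0" if "l \<noteq> i" for l
      using that \<open>i < n\<close> \<open>c i \<noteq> 0\<close> by (intro prod_zero) auto
    then have "(\<Sum>l<n. v l * (\<Prod>k\<in>{..<n} - {l}. 1 - c k * ?x)) =
        (\<Sum>l<n. if l = i then v i * (\<Prod>k\<in>{..<n} - {i}. 1 - c k * ?x) else 0)"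
      by (intro sum.cong) auto
    then have "v i * (\<Prod>k\<in>{..<n} - {i}. 1 - c k * ?x) = 0"
      using zero[of ?x] \<open>i < n\<close> by (simp only: sum.delta finite_lessThan lessThan_iff if_True)
    \<comment> \<open>A factor \<open>1 - c k / c i\<close> vanishes only if
      \<open>c k = c i\<close>, which injectivity excludes.\<close>
    moreover have "(\<Prod>k\<in>{..<n} - {i}. 1 - c k * ?x) \<noteq> 0"
      using inj that by (auto simp: inj_on_def field_simps)
    ultimately show ?thesis by (metis mult_eq_0_iff)
  qed
  show ?thesis
  proof (cases "c j = 0")
    case True
    have "v l = 0" if "l < n" "l \<noteq> j" for l
      using nz[OF \<open>l < n\<close>] inj that True \<open>j < n\<close> by (metis inj_onD lessThan_iff)
    then have "(\<Sum>l<n. v l) = (\<Sum>l<n. if l = j then v j else 0)"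
      by (intro sum.cong) auto
    \<comment> \<open>At 0 every product equals 1, so the hypothesis says that the plain sum of the
      \<open>v l\<close> vanishes.\<close>
    with zero[of 0] \<open>j < n\<close> show ?thesis by simp
  next
    case False
    with nz \<open>j < n\<close> show ?thesis by blast
  qed
qed

lemma det_cauchy_kernel_nonzero:
  fixes a c :: "nat \<Rightarrow> 'a :: field"
  assumes inja: "inj_on a {..<n}" and injc: "inj_on c {..<n}"
    and ne: "\<And>i j. i < n \<Longrightarrow> j < n \<Longrightarrow> c j * a i \<noteq> 1"
  shows "det (mat n n (\<lambda>(i, j). 1 / (1 - c j * a i))) \<noteq> 0"
proof
  let ?A = "mat n n (\<lambda>(i, j). 1 / (1 - c j * a i))"
  assume "det ?A = 0"
  then obtain v where v: "v \<in> carrier_vec n" "v \<noteq> 0\<^sub>v n" "?A *\<^sub>v v = 0\<^sub>v n"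
    using det_0_iff_vec_prod_zero_field[of ?A n] by auto
  \<comment> \<open>\<open>p\<close> is the numerator of the rational function \<Sum>j.
    \<open>v $ j / (1 - c j * x)\<close> over the common denominator \<Prod>k.
    \<open>1 - c k * x\<close>.\<close>
  define p where "p = (\<Sum>j<n. smult (v $ j) (\<Prod>k\<in>{..<n} - {j}. [:1, - c k:]))"
  have poly_p: "poly p x = (\<Sum>j<n. v $ j * (\<Prod>k\<in>{..<n} - {j}. 1 - c k * x))" for x
    by (simp add: p_def poly_sum poly_prod mult.commute)
  \<comment> \<open>A nonzero vector forces positive dimension; this turns the bound
    \<open>n - 1\<close> on the degree into a strict bound by \<open>n\<close>.\<close>
  have n: "n > 0"
    using v by (cases n) auto
  have deg: "degree p < n"
  proof -
    have "degree (smult (v $ j) (\<Prod>k\<in>{..<n} - {j}. [:1, - c k:])) \<le> n - 1" if "j < n" for j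
    proof -
      have "degree (\<Prod>k\<in>{..<n} - {j}. [:1, - c k:]) \<le> (\<Sum>k\<in>{..<n} - {j}. degree [:1, - c k:])"
        by (rule degree_prod_sum_le[unfolded o_def]) simp
      also have "\<dots> \<le> (\<Sum>k\<in>{..<n} - {j}. 1)"
        by (intro sum_mono) auto
      also have "\<dots> = n - 1"
        using that by simp
      finally show ?thesis
        using degree_smult_le order_trans by blast
    qed
    then have "degree p \<le> n - 1"
      unfolding p_def by (intro degree_sum_le) auto
    with n show ?thesis by simp
  qed
  have root: "poly p (a i) = 0" if i: "i < n" for i
  proof -
    \<comment> \<open>By \<open>ne\<close> no factor vanishes at \<open>a i\<close>, so omitting the
      factor \<open>j\<close> amounts to dividing the full product by it; row \<open>i\<close> of
      the null-vector equation then gives the root.\<close>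
    have "v $ j * (\<Prod>k\<in>{..<n} - {j}. 1 - c k * a i) =
        (\<Prod>k<n. 1 - c k * a i) * (1 / (1 - c j * a i) * v $ j)" if "j < n" for j
      using ne[OF i that] that by (simp add: prod.remove[of "{..<n}" j])
    then have "poly p (a i) = (\<Prod>k<n. 1 - c k * a i) * (\<Sum>j<n. 1 / (1 - c j * a i) * v $ j)"
      unfolding poly_p sum_distrib_left by (intro sum.cong) auto
    also have "(\<Sum>j<n. 1 / (1 - c j * a i) * v $ j) = (?A *\<^sub>v v) $ i"
      using v(1) i by (simp add: scalar_prod_def lessThan_atLeast0)
    finally show ?thesis
      using v(3) i by simp
  qed
  have "p = 0"
  proof (rule ccontr)
    assume "p \<noteq> 0"
    \<comment> \<open>The \<open>n\<close> distinct points \<open>a i\<close> are too many roots for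
      a nonzero polynomial of degree below \<open>n\<close>.\<close>
    have "n = card (a ` {..<n})"
      using inja by (simp add: card_image)
    also have "\<dots> \<le> card {x. poly p x = 0}"
      using root by (intro card_mono poly_roots_finite[OF \<open>p \<noteq> 0\<close>]) auto
    also have "\<dots> \<le> degree p"
      using \<open>p \<noteq> 0\<close> by (rule card_poly_roots_bound)
    finally show False using deg by simp
  qed
  then have "v $ j = 0" if "j < n" for j
    using sum_eq_0_kernel_polynomial_imp_0[OF injc _ that, of "\<lambda>j. v $ j"] poly_p by simp
  then have "v = 0\<^sub>v n"
    using v(1) by (intro eq_vecI) auto
  with v(2) show False by contradiction
qed

theorem proposition2p3:
  fixes n :: nat and a b :: "nat \<Rightarrow> complex"
  assumes "a ` {..<n} \<subseteq> unit_disk"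
    and "b ` {..<n} \<subseteq> unit_disk"
    and "inj_on a {..<n}"
    and "inj_on b {..<n}"
    and "a ` {..<n} \<inter> b ` {..<n} = {}"
  shows "det (mat n n (\<lambda>(i, j). szego_kernel (b j) (a i))) \<noteq> 0"
  unfolding szego_kernel_def
\<comment> \<open>Here \<open>c j\<close> is \<open>cnj (b j)\<close>. Denominators stay nonzero
  because a product of two points of modulus below 1 has modulus below 1.\<close>
proof (rule det_cauchy_kernel_nonzero)
  show "inj_on a {..<n}" by fact
  show "inj_on (\<lambda>j. cnj (b j)) {..<n}"
    using assms(4) by (simp add: inj_on_def)
  show "cnj (b j) * a i \<noteq> 1" if "i < n" "j < n" for i j
  proof
    assume "cnj (b j) * a i = 1"
    then have "cmod (b j) * cmod (a i) = 1"
      by (metis complex_mod_cnj norm_mult norm_one)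
    moreover have "cmod (b j) < 1" "cmod (a i) < 1"
      using assms(1,2) that by (auto simp: unit_disk_def)
    then have "cmod (b j) * cmod (a i) < 1"
      using mult_strict_mono'[of "cmod (b j)" 1 "cmod (a i)" 1] by simp
    ultimately show False by simp
  qed
qed

end
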